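(* Let $(Y_t(0),Y_t(1))_{t\ge1}$ be random variables on a probability space with $0\le Y_t(0),Y_t(1)\le1$ a.s. for all $t$, and let $\mathcal R:=\sigma(\{Y_t(0),Y_t(1):t\ge1\})$. Let $A_t\in\{0,1\}$, $t\ge1$, be random treatment assignments and define the observed outcomes $X_t:=A_tY_t(1)+(1-A_t)Y_t(0)$. Let $\mathcal F_t:=\sigma(A_1,X_1,\ldots,A_t,X_t)$ and $\mathcal H_t:=\mathcal R\vee\mathcal F_t$ for $t\ge0$ ($\mathcal F_0$ trivial). Assume that the assignment mechanism is sequentially randomized: for every $t\ge1$, $$\mathbb P(A_t=1\mid\mathcal H_{t-1})=q_t\quad\text{a.s.},$$ where $q_t\in[0,1]$ is $\mathcal F_{t-1}$-measurable. Define $m_t:=\mathbb E[X_t\mid\mathcal H_{t-1}]$. Then $$m_t=q_tY_t(1)+(1-q_t)Y_t(0)\quad\text{a.s.}$$ If moreover there exists a random variable $\theta$ such that $\frac1n\sum_{t=1}^nm_t\to\theta$ almost surely, then $\bar X_n:=\frac1n\sum_{t=1}^nX_t\to\theta$ almost surely.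
   Context: $\mathcal R\vee\mathcal F_t$ denotes the $\sigma$-algebra generated by $\mathcal R\cup\mathcal F_t$. The variables $Y_t(0),Y_t(1)$ are the potential outcomes of unit $t$. *)

theory Defs
  imports "HOL-Probability.Probability"
begin

text \<open>Sub-\<open>\<sigma>\<close>-algebras of a probability space \<open>M\<close> are represented, as in the library's theory
  of conditional expectation, by measures on \<open>space M\<close> of which only the measurable sets matter.\<close>

definition gen_sigma :: "'a set \<Rightarrow> ('a \<Rightarrow> real) set \<Rightarrow> 'a measure" where
  "gen_sigma \<Omega> Z = sigma \<Omega> (\<Union>f\<in>Z. sets (vimage_algebra \<Omega> f borel))"

definition join_sigma :: "'a set \<Rightarrow> 'a measure \<Rightarrow> 'a measure \<Rightarrow> 'a measure" where
  "join_sigma \<Omega> F G = sigma \<Omega> (sets F \<union> sets G)"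

text \<open>Time is indexed by \<^typ>\<open>nat\<close>, and units are the indices \<open>t \<ge> 1\<close>; the values of the
  processes at index \<open>0\<close> are never used.\<close>

definition observed ::
    "(nat \<Rightarrow> 'a \<Rightarrow> real) \<Rightarrow> (nat \<Rightarrow> 'a \<Rightarrow> real) \<Rightarrow> (nat \<Rightarrow> 'a \<Rightarrow> real) \<Rightarrow> nat \<Rightarrow> 'a \<Rightarrow> real" where
  "observed Y0 Y1 A t \<omega> = A t \<omega> * Y1 t \<omega> + (1 - A t \<omega>) * Y0 t \<omega>"

definition outcome_sigma ::
    "'a measure \<Rightarrow> (nat \<Rightarrow> 'a \<Rightarrow> real) \<Rightarrow> (nat \<Rightarrow> 'a \<Rightarrow> real) \<Rightarrow> 'a measure" where
  "outcome_sigma M Y0 Y1 = gen_sigma (space M) (Y0 ` {1..} \<union> Y1 ` {1..})"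

definition observed_sigma ::
    "'a measure \<Rightarrow> (nat \<Rightarrow> 'a \<Rightarrow> real) \<Rightarrow> (nat \<Rightarrow> 'a \<Rightarrow> real) \<Rightarrow> (nat \<Rightarrow> 'a \<Rightarrow> real) \<Rightarrow> nat
      \<Rightarrow> 'a measure" where
  "observed_sigma M Y0 Y1 A t =
     gen_sigma (space M) (A ` {1..t} \<union> observed Y0 Y1 A ` {1..t})"

definition history_sigma ::
    "'a measure \<Rightarrow> (nat \<Rightarrow> 'a \<Rightarrow> real) \<Rightarrow> (nat \<Rightarrow> 'a \<Rightarrow> real) \<Rightarrow> (nat \<Rightarrow> 'a \<Rightarrow> real) \<Rightarrow> nat
      \<Rightarrow> 'a measure" where
  "history_sigma M Y0 Y1 A t =
     join_sigma (space M) (outcome_sigma M Y0 Y1) (observed_sigma M Y0 Y1 A t)"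

definition cond_prob_sigma :: "'a measure \<Rightarrow> 'a measure \<Rightarrow> 'a set \<Rightarrow> 'a \<Rightarrow> real" where
  "cond_prob_sigma M F B = real_cond_exp M F (indicator B)"

definition cond_mean ::
    "'a measure \<Rightarrow> (nat \<Rightarrow> 'a \<Rightarrow> real) \<Rightarrow> (nat \<Rightarrow> 'a \<Rightarrow> real) \<Rightarrow> (nat \<Rightarrow> 'a \<Rightarrow> real) \<Rightarrow> nat
      \<Rightarrow> 'a \<Rightarrow> real" where
  "cond_mean M Y0 Y1 A t =
     real_cond_exp M (history_sigma M Y0 Y1 A (t - 1)) (observed Y0 Y1 A t)"

end

theory Submission
  imports Defs
begin

text \<open>Given \<open>\<H>\<^bsub>t-1\<^esub>\<close>, both potential outcomes of unit \<open>t\<close> are known and only the assignment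
  \<open>A\<^sub>t\<close> is random, so pulling \<open>Y\<^sub>t(1) - Y\<^sub>t(0)\<close> out of the conditional expectation of
  \<open>X\<^sub>t = A\<^sub>t (Y\<^sub>t(1) - Y\<^sub>t(0)) + Y\<^sub>t(0)\<close> gives the formula for \<open>m\<^sub>t\<close>.

  For the second part it suffices that the average of \<open>D\<^sub>t = X\<^sub>t - m\<^sub>t\<close> tends to \<open>0\<close> almost
  surely. These are martingale differences for the filtration \<open>\<H>\<^sub>t\<close>, bounded by \<open>1\<close>, but
  no martingale convergence theorem is needed: bounded martingale differences are pairwise orthogonal,
  and bounded orthogonal variables obey the strong law (\<open>bounded_orthogonal_strong_law\<close>).
  Indeed \<open>E[(D\<^sub>1 + \<dots> + D\<^sub>n)\<^sup>2] \<le> n\<close>, so along the squares \<open>n = k\<^sup>2\<close> the second moments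
  of the averages are at most \<open>1 / k\<^sup>2\<close>, which is summable; hence the averages
  tend to \<open>0\<close> along the squares. Boundedness of the \<open>D\<^sub>t\<close> fills the gaps between
  consecutive squares (\<open>averages_tendsto_0_if_squares\<close>).\<close>

section \<open>A strong law for bounded orthogonal variables\<close>

lemma averages_tendsto_0_if_squares:
  fixes d :: "nat \<Rightarrow> real"
  assumes bound: "\<And>t. t \<ge> 1 \<Longrightarrow> \<bar>d t\<bar> \<le> B"
    and squares: "(\<lambda>k. (\<Sum>t = 1..k\<^sup>2. d t) / real (k\<^sup>2)) \<longlonglongrightarrow> 0"
  shows "(\<lambda>n. (\<Sum>t = 1..n. d t) / real n) \<longlonglongrightarrow> 0"
proof -
  let ?a = "\<lambda>k. (\<Sum>t = 1..k\<^sup>2. d t) / real (k\<^sup>2)"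
  have B0: "B \<ge> 0" using bound[of 1] by simp
  have sqrt_top: "filterlim floor_sqrt at_top at_top"
    unfolding filterlim_at_top
  proof
    fix Z :: nat
    show "eventually (\<lambda>n. Z \<le> floor_sqrt n) at_top"
      using eventually_ge_at_top[of "Z\<^sup>2"] by eventually_elim (simp add: le_floor_sqrt_iff)
  qed
  have "(\<lambda>k. \<bar>?a k\<bar> + 2 * B / real k) \<longlonglongrightarrow> \<bar>0\<bar> + 0"
    by (intro tendsto_add tendsto_rabs squares lim_const_over_n)
  then have lim: "(\<lambda>n. \<bar>?a (floor_sqrt n)\<bar> + 2 * B / real (floor_sqrt n)) \<longlonglongrightarrow> 0"
    using filterlim_compose[OF _ sqrt_top] by simp
  have "eventually (\<lambda>n. norm ((\<Sum>t = 1..n. d t) / real n)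
          \<le> \<bar>?a (floor_sqrt n)\<bar> + 2 * B / real (floor_sqrt n)) at_top"
    using eventually_ge_at_top[of 1]
  proof eventually_elim
    case (elim n)
    define k where "k = floor_sqrt n"
    have k: "k > 0" "k\<^sup>2 \<le> n" "n < (Suc k)\<^sup>2"
      using elim Suc_floor_sqrt_power2_gt by (auto simp: k_def)
    have kn: "real (k\<^sup>2) \<le> real n" "real (k\<^sup>2) > 0"
      using k by (auto simp del: of_nat_power)
    \<comment> \<open>Between \<open>k\<^sup>2\<close> and \<open>(k + 1)\<^sup>2\<close> at most \<open>2k\<close> terms are added, which is negligible against \<open>k\<^sup>2\<close>.\<close>
    have "n \<le> k\<^sup>2 + 2 * k"
      using k(3) by (simp add: power2_eq_square)
    then have gap: "real n - real (k\<^sup>2) \<le> 2 * real k"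
      by (simp del: of_nat_power)
    have split: "(\<Sum>t = 1..n. d t) = (\<Sum>t = 1..k\<^sup>2. d t) + (\<Sum>t = k\<^sup>2+1..n. d t)"
      using sum.ub_add_nat[of 1 "k\<^sup>2" d "n - k\<^sup>2"] k(2) by simp
    have "\<bar>\<Sum>t = k\<^sup>2+1..n. d t\<bar> \<le> (\<Sum>t = k\<^sup>2+1..n. B)"
      by (rule order.trans[OF sum_abs sum_mono]) (simp add: bound)
    also have "\<dots> = (real n - real (k\<^sup>2)) * B"
      using k(2) by (simp add: of_nat_diff del: of_nat_power)
    also have "\<dots> \<le> 2 * real k * B"
      using gap B0 by (rule mult_right_mono)
    finally have tail: "\<bar>\<Sum>t = k\<^sup>2+1..n. d t\<bar> \<le> 2 * real k * B" .
    have "\<bar>\<Sum>t = 1..n. d t\<bar> / real n \<le> (\<bar>\<Sum>t = 1..k\<^sup>2. d t\<bar> + 2 * real k * B) / real (k\<^sup>2)"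
      using split tail kn B0 by (intro frac_le) auto
    also have "\<dots> = \<bar>?a k\<bar> + 2 * B / real k"
      using k(1) by (simp add: field_simps power2_eq_square)
    finally show ?case by (simp add: k_def)
  qed
  then show ?thesis
    by (rule Lim_null_comparison[OF _ lim])
qed

text \<open>By monotone convergence the sum of the squares has finite expectation, so it is finite almost
  everywhere and its terms tend to \<open>0\<close>.\<close>

lemma AE_tendsto_0_if_summable_second_moments:
  fixes Z :: "nat \<Rightarrow> 'a \<Rightarrow> real"
  assumes int: "\<And>k. integrable M (\<lambda>\<omega>. (Z k \<omega>)\<^sup>2)"
    and sum: "summable (\<lambda>k. \<integral>\<omega>. (Z k \<omega>)\<^sup>2 \<partial>M)"
  shows "AE \<omega> in M. (\<lambda>k. Z k \<omega>) \<longlonglongrightarrow> 0"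
proof -
  have [measurable]: "(\<lambda>\<omega>. (Z k \<omega>)\<^sup>2) \<in> borel_measurable M" for k
    using int by auto
  have "(\<integral>\<^sup>+\<omega>. (\<Sum>k. ennreal ((Z k \<omega>)\<^sup>2)) \<partial>M) = (\<Sum>k. \<integral>\<^sup>+\<omega>. ennreal ((Z k \<omega>)\<^sup>2) \<partial>M)"
    by (intro nn_integral_suminf) measurable
  also have "\<dots> = (\<Sum>k. ennreal (\<integral>\<omega>. (Z k \<omega>)\<^sup>2 \<partial>M))"
    by (simp add: nn_integral_eq_integral int)
  also have "\<dots> = ennreal (\<Sum>k. \<integral>\<omega>. (Z k \<omega>)\<^sup>2 \<partial>M)"
    using sum by (intro suminf_ennreal2) auto
  finally have "AE \<omega> in M. (\<Sum>k. ennreal ((Z k \<omega>)\<^sup>2)) \<noteq> \<infinity>"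
    by (intro nn_integral_PInf_AE) auto
  then show ?thesis
  proof eventually_elim
    case (elim \<omega>)
    then have "summable (\<lambda>k. (Z k \<omega>)\<^sup>2)"
      by (intro summable_suminf_not_top) auto
    then have "(\<lambda>k. (Z k \<omega>)\<^sup>2) \<longlonglongrightarrow> 0"
      by (rule summable_LIMSEQ_zero)
    from tendsto_real_sqrt[OF this] show ?case
      by (simp add: tendsto_rabs_zero_iff)
  qed
qed

theorem (in prob_space) bounded_orthogonal_strong_law:
  fixes D :: "nat \<Rightarrow> 'a \<Rightarrow> real"
  assumes meas: "\<And>t. t \<ge> 1 \<Longrightarrow> D t \<in> borel_measurable M"
    and bound: "\<And>t. t \<ge> 1 \<Longrightarrow> AE \<omega> in M. \<bar>D t \<omega>\<bar> \<le> B"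
    and orth: "\<And>s t. 1 \<le> s \<Longrightarrow> s < t \<Longrightarrow> expectation (\<lambda>\<omega>. D s \<omega> * D t \<omega>) = 0"
  shows "AE \<omega> in M. (\<lambda>n. (\<Sum>t = 1..n. D t \<omega>) / real n) \<longlonglongrightarrow> 0"
proof -
  have prod_bound: "AE \<omega> in M. norm (D s \<omega> * D t \<omega>) \<le> B * B" if "s \<ge> 1" "t \<ge> 1" for s t
    using bound[OF that(1)] bound[OF that(2)]
  proof eventually_elim
    case (elim \<omega>)
    then show ?case
      using mult_mono[of "\<bar>D s \<omega>\<bar>" B "\<bar>D t \<omega>\<bar>" B] by (simp add: abs_mult)
  qed
  have int: "integrable M (\<lambda>\<omega>. D s \<omega> * D t \<omega>)" if "s \<ge> 1" "t \<ge> 1" for s t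
    using prod_bound[OF that] meas[OF that(1)] meas[OF that(2)]
    by (intro integrable_const_bound[where B = "B * B"]) auto
  have diag: "expectation (\<lambda>\<omega>. D t \<omega> * D t \<omega>) \<le> B\<^sup>2" if "t \<ge> 1" for t
    using prod_bound[OF that that] int[OF that that]
    by (intro integral_le_const) (auto simp: power2_eq_square)
  have off_diag: "expectation (\<lambda>\<omega>. D s \<omega> * D t \<omega>) = 0" if "s \<ge> 1" "t \<ge> 1" "s \<noteq> t" for s t
    using orth[of s t] orth[of t s] that by (cases "s < t") (auto simp: mult.commute)
  let ?S = "\<lambda>n \<omega>. \<Sum>t = 1..n. D t \<omega>"
  have sq: "(?S n \<omega>)\<^sup>2 = (\<Sum>s = 1..n. \<Sum>t = 1..n. D s \<omega> * D t \<omega>)" for n \<omega>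
    by (simp add: power2_eq_square sum_product)
  have int_sq: "integrable M (\<lambda>\<omega>. (?S n \<omega>)\<^sup>2)" for n
    unfolding sq by (intro Bochner_Integration.integrable_sum int) auto
  have second_moment: "expectation (\<lambda>\<omega>. (?S n \<omega>)\<^sup>2) \<le> real n * B\<^sup>2" for n
  proof -
    have "expectation (\<lambda>\<omega>. (?S n \<omega>)\<^sup>2)
        = (\<Sum>s = 1..n. expectation (\<lambda>\<omega>. \<Sum>t = 1..n. D s \<omega> * D t \<omega>))"
      unfolding sq
      by (rule Bochner_Integration.integral_sum, rule Bochner_Integration.integrable_sum, rule int)
        auto
    also have "\<dots> = (\<Sum>s = 1..n. \<Sum>t = 1..n. expectation (\<lambda>\<omega>. D s \<omega> * D t \<omega>))"
    proof (rule sum.cong[OF refl])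
      fix s assume "s \<in> {1..n}"
      then show "expectation (\<lambda>\<omega>. \<Sum>t = 1..n. D s \<omega> * D t \<omega>)
          = (\<Sum>t = 1..n. expectation (\<lambda>\<omega>. D s \<omega> * D t \<omega>))"
        by (intro Bochner_Integration.integral_sum int) auto
    qed
    also have "\<dots> = (\<Sum>s = 1..n. \<Sum>t = 1..n. if t = s then expectation (\<lambda>\<omega>. D s \<omega> * D s \<omega>) else 0)"
      by (intro sum.cong refl) (auto simp: off_diag)
    also have "\<dots> = (\<Sum>s = 1..n. expectation (\<lambda>\<omega>. D s \<omega> * D s \<omega>))"
      by (intro sum.cong refl) (simp add: sum.delta)
    also have "\<dots> \<le> (\<Sum>s = 1..n. B\<^sup>2)"
      by (intro sum_mono diag) auto
    finally show ?thesis by simp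
  qed
  have "AE \<omega> in M. (\<lambda>k. ?S (k\<^sup>2) \<omega> / real (k\<^sup>2)) \<longlonglongrightarrow> 0"
  proof (rule AE_tendsto_0_if_summable_second_moments)
    show "integrable M (\<lambda>\<omega>. (?S (k\<^sup>2) \<omega> / real (k\<^sup>2))\<^sup>2)" for k
      unfolding power_divide by (intro integrable_divide int_sq)
    \<comment> \<open>For \<open>k = 0\<close> both sides are \<open>0\<close>, because division by zero yields \<open>0\<close>.\<close>
    have moment: "expectation (\<lambda>\<omega>. (?S (k\<^sup>2) \<omega> / real (k\<^sup>2))\<^sup>2) \<le> B\<^sup>2 * (1 / (real k)\<^sup>2)" for k
    proof -
      have "expectation (\<lambda>\<omega>. (?S (k\<^sup>2) \<omega> / real (k\<^sup>2))\<^sup>2)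
          = expectation (\<lambda>\<omega>. (?S (k\<^sup>2) \<omega>)\<^sup>2) / (real (k\<^sup>2))\<^sup>2"
        unfolding power_divide by simp
      also have "\<dots> \<le> real (k\<^sup>2) * B\<^sup>2 / (real (k\<^sup>2))\<^sup>2"
        by (intro divide_right_mono second_moment) simp
      also have "\<dots> = B\<^sup>2 * (1 / (real k)\<^sup>2)"
        by (simp add: power2_eq_square)
      finally show ?thesis .
    qed
    have "summable (\<lambda>k. B\<^sup>2 * (1 / (real k)\<^sup>2))"
      using inverse_power_summable[of 2, where 'a = real]
      by (intro summable_mult) (simp add: field_simps)
    then show "summable (\<lambda>k. expectation (\<lambda>\<omega>. (?S (k\<^sup>2) \<omega> / real (k\<^sup>2))\<^sup>2))"
    proof (rule summable_comparison_test'[where N = 0])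
      show "norm (expectation (\<lambda>\<omega>. (?S (k\<^sup>2) \<omega> / real (k\<^sup>2))\<^sup>2)) \<le> B\<^sup>2 * (1 / (real k)\<^sup>2)" for k
        unfolding real_norm_def
        by (subst abs_of_nonneg[OF Bochner_Integration.integral_nonneg[OF zero_le_power2]]) (rule moment)
    qed
  qed
  moreover have "AE \<omega> in M. \<forall>t. t \<ge> 1 \<longrightarrow> \<bar>D t \<omega>\<bar> \<le> B"
    unfolding AE_all_countable using bound by auto
  ultimately show ?thesis
  proof eventually_elim
    case (elim \<omega>)
    then show ?case
      by (intro averages_tendsto_0_if_squares[where B = B]) auto
  qed
qed

section \<open>Bounded martingale differences\<close>

text \<open>Here \<open>G t\<close> is the \<open>\<sigma>\<close>-algebra of the information available just before time \<open>t\<close>: the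
  variables \<open>X s\<close> with \<open>s < t\<close> are assumed measurable with respect to it.
  The differences from the conditional means are orthogonal, since an earlier difference is
  \<open>G t\<close>-measurable and can be used as a test function against \<open>X t\<close> and its conditional mean.\<close>

theorem (in prob_space) bounded_martingale_difference_strong_law:
  fixes X :: "nat \<Rightarrow> 'a \<Rightarrow> real" and G :: "nat \<Rightarrow> 'a measure"
  assumes sub: "\<And>t. t \<ge> 1 \<Longrightarrow> subalgebra M (G t)"
    and mono: "\<And>s t. 1 \<le> s \<Longrightarrow> s < t \<Longrightarrow> subalgebra (G t) (G s)"
    and adapted: "\<And>s t. 1 \<le> s \<Longrightarrow> s < t \<Longrightarrow> X s \<in> borel_measurable (G t)"
    and meas: "\<And>t. t \<ge> 1 \<Longrightarrow> X t \<in> borel_measurable M"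
    and range: "\<And>t. t \<ge> 1 \<Longrightarrow> AE \<omega> in M. a \<le> X t \<omega> \<and> X t \<omega> \<le> b"
  shows "AE \<omega> in M. (\<lambda>n. (\<Sum>t = 1..n. X t \<omega> - real_cond_exp M (G t) (X t) \<omega>) / real n) \<longlonglongrightarrow> 0"
proof (rule bounded_orthogonal_strong_law[where B = "b - a"])
  let ?m = "\<lambda>t. real_cond_exp M (G t) (X t)"
  have sf: "sigma_finite_subalgebra M (G t)" if "t \<ge> 1" for t
    by (intro finite_measure_subalgebra_is_sigma_finite finite_measure_subalgebra.intro
        finite_measure_subalgebra_axioms.intro finite_measure_axioms sub that)
  have int: "integrable M (X t)" if "t \<ge> 1" for t
  proof (rule integrable_const_bound[where B = "max \<bar>a\<bar> \<bar>b\<bar>"])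
    show "AE \<omega> in M. norm (X t \<omega>) \<le> max \<bar>a\<bar> \<bar>b\<bar>"
      using range[OF that] by eventually_elim auto
  qed (use meas that in auto)
  have m_int: "integrable M (?m t)" if "t \<ge> 1" for t
    using sigma_finite_subalgebra.real_cond_exp_int(1)[OF sf int] that by blast
  show meas_D: "(\<lambda>\<omega>. X t \<omega> - ?m t \<omega>) \<in> borel_measurable M" if "t \<ge> 1" for t
    using meas[OF that] by simp
  show bound: "AE \<omega> in M. \<bar>X t \<omega> - ?m t \<omega>\<bar> \<le> b - a" if "t \<ge> 1" for t
  proof -
    have "AE \<omega> in M. ?m t \<omega> \<ge> a" "AE \<omega> in M. ?m t \<omega> \<le> b"
      using range[OF that]
        sigma_finite_subalgebra.real_cond_exp_ge_c[OF sf[OF that] int[OF that], where c = a]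
        sigma_finite_subalgebra.real_cond_exp_le_c[OF sf[OF that] int[OF that], where c = b]
      by auto
    then show ?thesis
      using range[OF that] by eventually_elim auto
  qed
  show "expectation (\<lambda>\<omega>. (X s \<omega> - ?m s \<omega>) * (X t \<omega> - ?m t \<omega>)) = 0" if "1 \<le> s" "s < t" for s t
  proof -
    have t: "t \<ge> 1" using that by simp
    let ?D = "\<lambda>\<omega>. X s \<omega> - ?m s \<omega>"
    have "?m s \<in> borel_measurable (G t)"
      by (rule measurable_from_subalg[OF mono[OF that]]) simp
    then have D_G: "?D \<in> borel_measurable (G t)"
      using adapted[OF that] by simp
    have prod_int: "integrable M (\<lambda>\<omega>. ?D \<omega> * X t \<omega>)"
    proof (rule Bochner_Integration.integrable_bound)
      show "integrable M (\<lambda>\<omega>. (b - a) * X t \<omega>)"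
        using int[OF t] by simp
      show "(\<lambda>\<omega>. ?D \<omega> * X t \<omega>) \<in> borel_measurable M"
        using meas_D[OF that(1)] meas[OF t] by simp
      show "AE \<omega> in M. norm (?D \<omega> * X t \<omega>) \<le> norm ((b - a) * X t \<omega>)"
        using bound[OF that(1)]
        by eventually_elim (auto simp: abs_mult intro!: mult_right_mono)
    qed
    note tower = sigma_finite_subalgebra.real_cond_exp_intg[OF sf[OF t] prod_int D_G meas[OF t]]
    have "expectation (\<lambda>\<omega>. ?D \<omega> * (X t \<omega> - ?m t \<omega>))
        = expectation (\<lambda>\<omega>. ?D \<omega> * X t \<omega>) - expectation (\<lambda>\<omega>. ?D \<omega> * ?m t \<omega>)"
      unfolding right_diff_distrib
      by (rule Bochner_Integration.integral_diff[OF prod_int tower(1)])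
    then show ?thesis using tower(2) by simp
  qed
qed

section \<open>The \<open>\<sigma>\<close>-algebras of the experiment\<close>

lemma space_gen_sigma [simp]: "space (gen_sigma \<Omega> Z) = \<Omega>"
  by (simp add: gen_sigma_def space_measure_of_conv)

lemma space_join_sigma [simp]: "space (join_sigma \<Omega> F G) = \<Omega>"
  by (simp add: join_sigma_def space_measure_of_conv)

lemma sets_gen_sigma:
  "sets (gen_sigma \<Omega> Z) = sigma_sets \<Omega> (\<Union>f\<in>Z. sets (vimage_algebra \<Omega> f borel))"
  unfolding gen_sigma_def
  using sets.sets_into_space[of _ "vimage_algebra \<Omega> _ borel"] by (intro sets_measure_of) auto

lemma measurable_gen_sigma:
  assumes "f \<in> Z"
  shows "f \<in> borel_measurable (gen_sigma \<Omega> Z)"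
proof (rule measurableI)
  fix S :: "real set" assume "S \<in> sets borel"
  then have "f -` S \<inter> \<Omega> \<in> sets (vimage_algebra \<Omega> f borel)"
    by (rule in_vimage_algebra)
  then show "f -` S \<inter> space (gen_sigma \<Omega> Z) \<in> sets (gen_sigma \<Omega> Z)"
    using assms by (auto simp: sets_gen_sigma)
qed simp

lemma subalgebra_gen_sigma:
  assumes "space N = \<Omega>" and "\<And>f. f \<in> Z \<Longrightarrow> f \<in> borel_measurable N"
  shows "subalgebra N (gen_sigma \<Omega> Z)"
proof -
  have "sets (vimage_algebra \<Omega> f borel) \<subseteq> sets N" if "f \<in> Z" for f
    using measurable_sets[OF assms(2)[OF that]] assms(1)
    by (subst sets_vimage_algebra2) auto
  then have "(\<Union>f\<in>Z. sets (vimage_algebra \<Omega> f borel)) \<subseteq> sets N"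
    by blast
  then have "sigma_sets \<Omega> (\<Union>f\<in>Z. sets (vimage_algebra \<Omega> f borel)) \<subseteq> sets N"
    unfolding assms(1)[symmetric] by (rule sets.sigma_sets_subset)
  then show ?thesis
    using assms(1) by (simp add: subalgebra_def sets_gen_sigma)
qed

lemma sets_join_sigma:
  assumes "space F = \<Omega>" "space G = \<Omega>"
  shows "sets (join_sigma \<Omega> F G) = sigma_sets \<Omega> (sets F \<union> sets G)"
  unfolding join_sigma_def
  using assms sets.sets_into_space[of _ F] sets.sets_into_space[of _ G]
  by (intro sets_measure_of) auto

lemma subalgebra_join_sigma:
  assumes "subalgebra N F" "subalgebra N G" "space N = \<Omega>"
  shows "subalgebra N (join_sigma \<Omega> F G)"
proof -
  have "sigma_sets (space N) (sets F \<union> sets G) \<subseteq> sets N"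
    using assms by (intro sets.sigma_sets_subset) (auto simp: subalgebra_def)
  then show ?thesis
    using assms by (simp add: subalgebra_def sets_join_sigma)
qed

lemma subalgebra_join_sigma_left:
  assumes "space F = \<Omega>" "space G = \<Omega>"
  shows "subalgebra (join_sigma \<Omega> F G) F"
  using assms by (auto simp: subalgebra_def sets_join_sigma)

lemma subalgebra_join_sigma_right:
  assumes "space F = \<Omega>" "space G = \<Omega>"
  shows "subalgebra (join_sigma \<Omega> F G) G"
  using assms by (auto simp: subalgebra_def sets_join_sigma)

lemma space_history_sigma [simp]: "space (history_sigma M Y0 Y1 A t) = space M"
  by (simp add: history_sigma_def)

lemma subalgebra_history_sigma_outcome:
  "subalgebra (history_sigma M Y0 Y1 A t) (outcome_sigma M Y0 Y1)"
  unfolding history_sigma_def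
  by (rule subalgebra_join_sigma_left) (simp_all add: outcome_sigma_def observed_sigma_def)

lemma subalgebra_history_sigma_observed:
  "subalgebra (history_sigma M Y0 Y1 A t) (observed_sigma M Y0 Y1 A t)"
  unfolding history_sigma_def
  by (rule subalgebra_join_sigma_right) (simp_all add: outcome_sigma_def observed_sigma_def)

lemma potential_outcome_measurable_history_sigma:
  assumes "t \<ge> 1"
  shows "Y0 t \<in> borel_measurable (history_sigma M Y0 Y1 A n)"
    and "Y1 t \<in> borel_measurable (history_sigma M Y0 Y1 A n)"
  using assms
  by (auto intro!: measurable_from_subalg[OF subalgebra_history_sigma_outcome]
      measurable_gen_sigma simp: outcome_sigma_def)

lemma observed_measurable_observed_sigma:
  assumes "1 \<le> s" "s \<le> t"
  shows "A s \<in> borel_measurable (observed_sigma M Y0 Y1 A t)"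
    and "observed Y0 Y1 A s \<in> borel_measurable (observed_sigma M Y0 Y1 A t)"
  using assms by (auto intro!: measurable_gen_sigma simp: observed_sigma_def)

lemma subalgebra_history_sigma:
  assumes "space N = space M"
    and "\<And>t. t \<ge> 1 \<Longrightarrow> Y0 t \<in> borel_measurable N"
    and "\<And>t. t \<ge> 1 \<Longrightarrow> Y1 t \<in> borel_measurable N"
    and "\<And>t. 1 \<le> t \<Longrightarrow> t \<le> n \<Longrightarrow> A t \<in> borel_measurable N"
    and "\<And>t. 1 \<le> t \<Longrightarrow> t \<le> n \<Longrightarrow> observed Y0 Y1 A t \<in> borel_measurable N"
  shows "subalgebra N (history_sigma M Y0 Y1 A n)"
  unfolding history_sigma_def outcome_sigma_def observed_sigma_def
  using assms by (intro subalgebra_join_sigma subalgebra_gen_sigma) auto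

lemma subalgebra_history_sigma_mono:
  assumes "s \<le> t"
  shows "subalgebra (history_sigma M Y0 Y1 A t) (history_sigma M Y0 Y1 A s)"
proof (rule subalgebra_history_sigma)
  fix r assume "1 \<le> r" "r \<le> s"
  with assms have r: "1 \<le> r" "r \<le> t" by auto
  show "A r \<in> borel_measurable (history_sigma M Y0 Y1 A t)"
    "observed Y0 Y1 A r \<in> borel_measurable (history_sigma M Y0 Y1 A t)"
    by (rule measurable_from_subalg[OF subalgebra_history_sigma_observed
          observed_measurable_observed_sigma(1)[OF r]],
        rule measurable_from_subalg[OF subalgebra_history_sigma_observed
          observed_measurable_observed_sigma(2)[OF r]])
qed (simp_all add: potential_outcome_measurable_history_sigma)

section \<open>Conditional means under sequential randomization\<close>

lemma (in sigma_finite_subalgebra) real_cond_exp_affine: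
  assumes "U \<in> borel_measurable F" "V \<in> borel_measurable F" "f \<in> borel_measurable M"
    and "integrable M (\<lambda>\<omega>. U \<omega> * f \<omega>)" "integrable M V"
  shows "AE \<omega> in M. real_cond_exp M F (\<lambda>\<omega>. U \<omega> * f \<omega> + V \<omega>) \<omega>
    = U \<omega> * real_cond_exp M F f \<omega> + V \<omega>"
  using real_cond_exp_add[OF assms(4,5)] real_cond_exp_mult[OF assms(1,3,4)]
    real_cond_exp_F_meas[OF assms(5,2)]
  by eventually_elim simp

theorem proposition10:
  fixes M :: "'a measure"
    and Y0 Y1 A q :: "nat \<Rightarrow> 'a \<Rightarrow> real"
  assumes "prob_space M"
    and "\<And>t. t \<ge> 1 \<Longrightarrow> Y0 t \<in> borel_measurable M"
    and "\<And>t. t \<ge> 1 \<Longrightarrow> Y1 t \<in> borel_measurable M"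
    and "\<And>t. t \<ge> 1 \<Longrightarrow> AE \<omega> in M. 0 \<le> Y0 t \<omega> \<and> Y0 t \<omega> \<le> 1"
    and "\<And>t. t \<ge> 1 \<Longrightarrow> AE \<omega> in M. 0 \<le> Y1 t \<omega> \<and> Y1 t \<omega> \<le> 1"
    and "\<And>t. t \<ge> 1 \<Longrightarrow> A t \<in> borel_measurable M"
    and "\<And>t \<omega>. t \<ge> 1 \<Longrightarrow> \<omega> \<in> space M \<Longrightarrow> A t \<omega> \<in> {0, 1}"
    and "\<And>t. t \<ge> 1 \<Longrightarrow> q t \<in> borel_measurable (observed_sigma M Y0 Y1 A (t - 1))"
    and "\<And>t \<omega>. t \<ge> 1 \<Longrightarrow> \<omega> \<in> space M \<Longrightarrow> q t \<omega> \<in> {0..1}"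
    and "\<And>t. t \<ge> 1 \<Longrightarrow>
           AE \<omega> in M. cond_prob_sigma M (history_sigma M Y0 Y1 A (t - 1))
                        {\<omega> \<in> space M. A t \<omega> = 1} \<omega> = q t \<omega>"
  shows "(\<forall>t\<ge>1. AE \<omega> in M.
            cond_mean M Y0 Y1 A t \<omega> = q t \<omega> * Y1 t \<omega> + (1 - q t \<omega>) * Y0 t \<omega>) \<and>
         (\<forall>\<theta> \<in> borel_measurable M.
            (AE \<omega> in M. (\<lambda>n. 1 / real n * (\<Sum>t = 1..n. cond_mean M Y0 Y1 A t \<omega>)) \<longlonglongrightarrow> \<theta> \<omega>) \<longrightarrow>
            (AE \<omega> in M. (\<lambda>n. 1 / real n * (\<Sum>t = 1..n. observed Y0 Y1 A t \<omega>)) \<longlonglongrightarrow> \<theta> \<omega>))"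
proof -
  interpret prob_space M by fact
  note Y0 = assms(2) and Y1 = assms(3) and Y0_range = assms(4) and Y1_range = assms(5)
    and A = assms(6) and A01 = assms(7)
  let ?H = "history_sigma M Y0 Y1 A"
  let ?X = "observed Y0 Y1 A"
  have X_eq: "?X t = (\<lambda>\<omega>. (Y1 t \<omega> - Y0 t \<omega>) * A t \<omega> + Y0 t \<omega>)" for t
    by (auto simp: observed_def algebra_simps)
  have X: "?X t \<in> borel_measurable M" if "t \<ge> 1" for t
    using Y0[OF that] Y1[OF that] A[OF that] by (simp add: X_eq)
  have sub: "subalgebra M (?H n)" for n
    by (rule subalgebra_history_sigma) (simp_all add: Y0 Y1 A X)
  have sf: "sigma_finite_subalgebra M (?H n)" for n
    by (intro finite_measure_subalgebra_is_sigma_finite finite_measure_subalgebra.intro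
        finite_measure_subalgebra_axioms.intro finite_measure_axioms sub)
  have mean: "AE \<omega> in M. cond_mean M Y0 Y1 A t \<omega> = q t \<omega> * Y1 t \<omega> + (1 - q t \<omega>) * Y0 t \<omega>"
    if t: "t \<ge> 1" for t
  proof -
    interpret H: sigma_finite_subalgebra M "?H (t - 1)" by (rule sf)
    have int_V: "integrable M (Y0 t)"
      using Y0_range[OF t] Y0[OF t] by (intro integrable_const_bound[where B = 1]) auto
    have int_UA: "integrable M (\<lambda>\<omega>. (Y1 t \<omega> - Y0 t \<omega>) * A t \<omega>)"
    proof (rule integrable_const_bound[where B = 1])
      show "AE \<omega> in M. norm ((Y1 t \<omega> - Y0 t \<omega>) * A t \<omega>) \<le> 1"
        using Y0_range[OF t] Y1_range[OF t] AE_space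
      proof eventually_elim
        case (elim \<omega>)
        then show ?case using A01[OF t, of \<omega>] by auto
      qed
    qed (use Y0[OF t] Y1[OF t] A[OF t] in simp)
    have A_ind: "AE \<omega> in M. A t \<omega> = indicator {\<omega> \<in> space M. A t \<omega> = 1} \<omega>"
      using AE_space
    proof eventually_elim
      case (elim \<omega>)
      then show ?case using A01[OF t, of \<omega>] by (auto simp: indicator_def)
    qed
    have "AE \<omega> in M. real_cond_exp M (?H (t - 1)) (A t) \<omega>
        = cond_prob_sigma M (?H (t - 1)) {\<omega> \<in> space M. A t \<omega> = 1} \<omega>"
      unfolding cond_prob_sigma_def
      using A[OF t] by (intro H.real_cond_exp_cong[OF A_ind]) auto
    moreover have "AE \<omega> in M. cond_mean M Y0 Y1 A t \<omega>
        = (Y1 t \<omega> - Y0 t \<omega>) * real_cond_exp M (?H (t - 1)) (A t) \<omega> + Y0 t \<omega>"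
      unfolding cond_mean_def X_eq
      by (rule H.real_cond_exp_affine[OF borel_measurable_diff[OF
              potential_outcome_measurable_history_sigma(2)[OF t]
              potential_outcome_measurable_history_sigma(1)[OF t]]
            potential_outcome_measurable_history_sigma(1)[OF t] A[OF t] int_UA int_V])
    ultimately show ?thesis
      using assms(10)[OF t] by eventually_elim (simp add: algebra_simps)
  qed
  have "AE \<omega> in M. (\<lambda>n. (\<Sum>t = 1..n. ?X t \<omega> - real_cond_exp M (?H (t - 1)) (?X t) \<omega>) / real n)
      \<longlonglongrightarrow> 0"
  proof (rule bounded_martingale_difference_strong_law[where a = 0 and b = 1])
    show "subalgebra (?H (t - 1)) (?H (s - 1))" if "1 \<le> s" "s < t" for s t
      using that by (intro subalgebra_history_sigma_mono) auto
    show "?X s \<in> borel_measurable (?H (t - 1))" if "1 \<le> s" "s < t" for s t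
      using that by (intro measurable_from_subalg[OF subalgebra_history_sigma_observed]
          observed_measurable_observed_sigma) auto
    show "AE \<omega> in M. 0 \<le> ?X t \<omega> \<and> ?X t \<omega> \<le> 1" if t: "t \<ge> 1" for t
      using Y0_range[OF t] Y1_range[OF t] AE_space
    proof eventually_elim
      case (elim \<omega>)
      then show ?case using A01[OF t, of \<omega>] by (auto simp: observed_def)
    qed
  qed (use sub X in auto)
  then have diff: "AE \<omega> in M. (\<lambda>n. (\<Sum>t = 1..n. ?X t \<omega> - cond_mean M Y0 Y1 A t \<omega>) / real n)
      \<longlonglongrightarrow> 0"
    by (simp add: cond_mean_def)
  have "AE \<omega> in M. (\<lambda>n. 1 / real n * (\<Sum>t = 1..n. ?X t \<omega>)) \<longlonglongrightarrow> \<theta> \<omega>"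
    if "AE \<omega> in M. (\<lambda>n. 1 / real n * (\<Sum>t = 1..n. cond_mean M Y0 Y1 A t \<omega>)) \<longlonglongrightarrow> \<theta> \<omega>" for \<theta>
    using that diff
  proof eventually_elim
    case (elim \<omega>)
    from tendsto_add[OF elim] show ?case
      by (simp add: sum_subtractf diff_divide_distrib)
  qed
  with mean show ?thesis by blast
qed

end
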